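(* Let $\mathbb{K}^2$ be the Klein bottle and let $\tau:\mathbb{K}^2\to\mathbb{K}^2$ be a free involution. A homotopy class $\beta\in[\mathbb{K}^2,\mathbb{K}^2]$ has the Borsuk-Ulam property with respect to $\tau$ if and only if $\beta$ lifts to the torus.
   Context: $[M,N]$ denotes the set of free homotopy classes of continuous maps $M\to N$. A homotopy class $\beta\in[M,N]$ has the Borsuk-Ulam property with respect to a free involution $\tau:M\to M$ if for every continuous map $f:M\to N$ with $f\in\beta$ there exists $x\in M$ such that $f(\tau(x))=f(x)$. Let $c_2:\mathbb{T}^2\to\mathbb{K}^2$ be the double covering of the Klein bottle by the torus (the orientation double covering). A class $\beta\in[\mathbb{K}^2,\mathbb{K}^2]$ lifts to the torus if a representative map $f:\mathbb{K}^2\to\mathbb{K}^2$ of $\beta$ admits a continuous lift $\widetilde f:\mathbb{K}^2\to\mathbb{T}^2$ with $c_2\circ\widetilde f=f$ (by the homotopy lifting property this does not depend on the representative). *)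

theory Defs
  imports "HOL-Analysis.Analysis"
begin

definition quotient_topology :: "'a topology \<Rightarrow> ('a \<Rightarrow> 'b) \<Rightarrow> 'b topology" where
  "quotient_topology X q =
     topology (\<lambda>U. U \<subseteq> q ` topspace X \<and> openin X {x \<in> topspace X. q x \<in> U})"

lemma openin_quotient_topology:
  "openin (quotient_topology X q) U \<longleftrightarrow>
     U \<subseteq> q ` topspace X \<and> openin X {x \<in> topspace X. q x \<in> U}"
proof -
  have "istopology (\<lambda>U. U \<subseteq> q ` topspace X \<and> openin X {x \<in> topspace X. q x \<in> U})"
    unfolding istopology_def
  proof (intro conjI allI impI)
    fix S T
    assume S: "S \<subseteq> q ` topspace X \<and> openin X {x \<in> topspace X. q x \<in> S}"
      and T: "T \<subseteq> q ` topspace X \<and> openin X {x \<in> topspace X. q x \<in> T}"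
    show "S \<inter> T \<subseteq> q ` topspace X"
      using S by blast
    have "{x \<in> topspace X. q x \<in> S \<inter> T} =
          {x \<in> topspace X. q x \<in> S} \<inter> {x \<in> topspace X. q x \<in> T}"
      by blast
    then show "openin X {x \<in> topspace X. q x \<in> S \<inter> T}"
      using S T by (simp only: openin_Int)
  next
    fix \<K>
    assume K: "\<forall>K\<in>\<K>. K \<subseteq> q ` topspace X \<and> openin X {x \<in> topspace X. q x \<in> K}"
    show "\<Union>\<K> \<subseteq> q ` topspace X"
      using K by blast
    have "{x \<in> topspace X. q x \<in> \<Union>\<K>} = (\<Union>K\<in>\<K>. {x \<in> topspace X. q x \<in> K})"
      by blast
    then show "openin X {x \<in> topspace X. q x \<in> \<Union>\<K>}"
      using K by auto
  qed
  then show ?thesis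
    by (simp add: quotient_topology_def topology_inverse')
qed

lemma topspace_quotient_topology [simp]: "topspace (quotient_topology X q) = q ` topspace X"
proof
  show "topspace (quotient_topology X q) \<subseteq> q ` topspace X"
    using openin_topspace[of "quotient_topology X q"] by (simp only: openin_quotient_topology)
  have "{x \<in> topspace X. q x \<in> q ` topspace X} = topspace X"
    by blast
  then have "openin (quotient_topology X q) (q ` topspace X)"
    by (simp add: openin_quotient_topology)
  then show "q ` topspace X \<subseteq> topspace (quotient_topology X q)"
    by (rule openin_subset)
qed

lemma quotient_map_quotient_topology: "quotient_map X (quotient_topology X q) q"
  by (simp add: quotient_map_def openin_quotient_topology)

definition torus :: "(complex \<times> complex) topology" where
  "torus = top_of_set (sphere 0 1 \<times> sphere 0 1)"

(* An orientation-reversing free involution of the torus: its orbit space is the Klein bottle,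
   and the projection is the orientation double covering. *)
definition torus_deck :: "complex \<times> complex \<Rightarrow> complex \<times> complex" where
  "torus_deck = (\<lambda>(z, w). (- z, cnj w))"

definition c2 :: "complex \<times> complex \<Rightarrow> (complex \<times> complex) set" where
  "c2 p = {p, torus_deck p}"

definition klein_bottle :: "(complex \<times> complex) set topology" where
  "klein_bottle = quotient_topology torus c2"

lemma torus_deck_involutive: "torus_deck (torus_deck p) = p"
  by (cases p) (simp add: torus_deck_def)

lemma torus_deck_in_torus: "p \<in> topspace torus \<Longrightarrow> torus_deck p \<in> topspace torus"
  by (cases p) (simp add: torus_deck_def torus_def)

lemma torus_deck_free: "p \<in> topspace torus \<Longrightarrow> torus_deck p \<noteq> p"
  by (cases p) (auto simp: torus_deck_def torus_def)

lemma c2_eq_iff: "c2 p = c2 q \<longleftrightarrow> q = p \<or> q = torus_deck p"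
  using torus_deck_involutive[of p] torus_deck_involutive[of q]
  by (auto simp: c2_def doubleton_eq_iff)

lemma quotient_map_c2: "quotient_map torus klein_bottle c2"
  unfolding klein_bottle_def by (rule quotient_map_quotient_topology)

(* HOL functions are total, but homotopic_with does not constrain values outside topspace X:
   maps agreeing on topspace X lie in the same class. *)
definition free_homotopy_classes :: "'a topology \<Rightarrow> 'b topology \<Rightarrow> ('a \<Rightarrow> 'b) set set" where
  "free_homotopy_classes X Y =
     {f. continuous_map X Y f} // {(f, g). homotopic_with (\<lambda>_. True) X Y f g}"

lemma equiv_homotopic:
  "equiv {f. continuous_map X Y f} {(f, g). homotopic_with (\<lambda>_. True) X Y f g}"
proof (rule equivI)
  show "{(f, g). homotopic_with (\<lambda>_. True) X Y f g}
          \<subseteq> {f. continuous_map X Y f} \<times> {f. continuous_map X Y f}"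
    by (auto dest: homotopic_with_imp_continuous_maps)
  show "refl_on {f. continuous_map X Y f} {(f, g). homotopic_with (\<lambda>_. True) X Y f g}"
    by (simp add: refl_on_def)
  show "sym {(f, g). homotopic_with (\<lambda>_. True) X Y f g}"
    by (simp add: sym_def homotopic_with_sym)
  show "trans {(f, g). homotopic_with (\<lambda>_. True) X Y f g}"
    by (auto intro!: transI intro: homotopic_with_trans)
qed

definition free_involution :: "'a topology \<Rightarrow> ('a \<Rightarrow> 'a) \<Rightarrow> bool" where
  "free_involution X \<tau> \<longleftrightarrow>
     continuous_map X X \<tau> \<and> (\<forall>x\<in>topspace X. \<tau> (\<tau> x) = x \<and> \<tau> x \<noteq> x)"

definition borsuk_ulam :: "'a topology \<Rightarrow> ('a \<Rightarrow> 'a) \<Rightarrow> ('a \<Rightarrow> 'b) set \<Rightarrow> bool" where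
  "borsuk_ulam X \<tau> \<beta> \<longleftrightarrow> (\<forall>f\<in>\<beta>. \<exists>x\<in>topspace X. f (\<tau> x) = f x)"

definition lifts_to_torus :: "'a topology \<Rightarrow> ('a \<Rightarrow> (complex \<times> complex) set) set \<Rightarrow> bool" where
  "lifts_to_torus X \<beta> \<longleftrightarrow>
     (\<exists>f\<in>\<beta>. \<exists>f'. continuous_map X torus f' \<and> (\<forall>x\<in>topspace X. c2 (f' x) = f x))"

end

theory Submission
  imports Defs
begin

text \<open>
  The Klein bottle is the quotient of the plane by the group of the maps
  \<open>deck m n\<close>, generated by the glide reflection \<open>a = deck 1 0\<close> and the
  translation \<open>b = deck 0 1\<close>, with the single relation \<open>b a b = a\<close>; the torus is the
  quotient by the subgroup of those with \<open>m\<close> even. Everything is read off from lifts to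
  the plane.

  \<^emph>\<open>The lifting class.\<close> A self-map of the Klein bottle lifts to \<open>F\<close> with
  \<open>F \<circ> a = deck r s \<circ> F\<close> and \<open>F \<circ> b = deck 0 v \<circ> F\<close>, where the relation forces
  \<open>v = 0\<close> if \<open>r\<close> is even (\<open>equivariant_lift\<close>). The map lifts to the torus exactly when
  \<open>r\<close> is even (\<open>lifts_to_torus_iff_even\<close>), and this is a homotopy invariant.

  \<^emph>\<open>The involution.\<close> Up to a choice of lift, every free involution looks like
  translation by half of \<open>b\<close>: it has a lift \<open>\<sigma>\<close> with \<open>\<sigma>\<^sup>2 = b\<close> and
  \<open>\<sigma> a = b a \<sigma>\<close> (\<open>free_involution_normal_lift\<close>). The algebra of the
  group leaves a few other possibilities, and in each of them some lift of the involution is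
  an involution of the plane, hence has a fixed point.

  \<^emph>\<open>Logarithms.\<close> One argument serves both for that fixed point and for the
  Borsuk-Ulam property. If \<open>D\<close> is a nowhere vanishing function on the plane with
  \<open>D \<circ> \<sigma> = - D\<close>, a continuous logarithm \<open>L\<close> of \<open>D\<close> satisfies
  \<open>L \<circ> \<sigma> = L + \<kappa>\<close> with a constant \<open>\<kappa> \<noteq> 0\<close>, so \<open>L\<close> grows by \<open>2 \<kappa>\<close>
  under \<open>\<sigma>\<^sup>2\<close>. This is absurd if \<open>\<sigma>\<^sup>2\<close> is the identity. If \<open>r\<close> is even and
  \<open>f\<close> has no coincidence, it applies to \<open>D = F \<circ> \<sigma> - F\<close>: then \<open>L\<close> grows by
  \<open>2 \<kappa>\<close> under \<open>b\<close>, while \<open>D\<close> is invariant under \<open>a\<close>, so that \<open>L\<close> changes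
  by a constant under \<open>a\<close>, and \<open>b a b = a\<close> gives \<open>4 \<kappa> = 0\<close>
  (\<open>lifted_map_has_coincidence\<close>).

  \<^emph>\<open>Odd classes.\<close> If \<open>r\<close> is odd, averaging over \<open>\<sigma>\<close> yields functions \<open>X\<close>
  and \<open>Y\<close> on the plane that transform under the deck group like the two coordinates, while
  \<open>\<sigma>\<close> fixes \<open>X\<close> and adds exactly \<open>1/2\<close> to \<open>Y\<close>. An explicit equivariant map
  without coincidences can be written down in terms of them
  (\<open>coincidence_free_equivariant_map\<close>). It has the same \<open>r, s, v\<close> as the given
  map, so the two are homotopic along straight lines in the plane.
\<close>

section \<open>The plane covering the torus and the Klein bottle\<close>

text \<open>The deck transformations of the universal covering of the Klein bottle, in coordinates in
which the torus has the lattice generated by \<open>(2, 0)\<close> and \<open>(0, 1)\<close>.\<close>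

definition deck :: "int \<Rightarrow> int \<Rightarrow> real \<times> real \<Rightarrow> real \<times> real" where
  "deck m n u = (fst u + of_int m, (if even m then snd u else - snd u) + of_int n)"

definition torus_cover :: "real \<times> real \<Rightarrow> complex \<times> complex" where
  "torus_cover u = (cis (pi * fst u), cis (2 * pi * snd u))"

definition kb_cover :: "real \<times> real \<Rightarrow> (complex \<times> complex) set" where
  "kb_cover u = c2 (torus_cover u)"

lemma deck_deck:
  "deck m n (deck m' n' u) = deck (m + m') ((if even m then n' else - n') + n) u"
  by (auto simp: deck_def)

lemma deck_0 [simp]: "deck 0 0 u = u"
  by (simp add: deck_def)

lemma deck_inject: "deck m n u = deck m' n' u \<longleftrightarrow> m = m' \<and> n = n'"
  by (auto simp: deck_def)

lemma continuous_on_deck [continuous_intros]: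
  assumes "continuous_on S f"
  shows "continuous_on S (\<lambda>x. deck m n (f x))"
  unfolding deck_def using assms by (cases "even m") (auto intro!: continuous_intros)

lemma cis_eq_iff: "cis x = cis y \<longleftrightarrow> (\<exists>n::int. x = y + 2 * pi * of_int n)"
proof -
  have "cis x = cis y \<longleftrightarrow> (\<exists>n::int. \<i> * of_real x = \<i> * of_real y + (of_int (2 * n) * pi) * \<i>)"
    by (simp only: cis_conv_exp exp_eq)
  also have "\<dots> \<longleftrightarrow> (\<exists>n::int. x = y + 2 * pi * of_int n)"
    by (auto simp: complex_eq_iff algebra_simps)
  finally show ?thesis .
qed

lemma cis_pi_eq_iff: "cis (pi * x) = cis (pi * y) \<longleftrightarrow> (\<exists>n::int. x = y + 2 * of_int n)"
proof -
  have "pi * x = pi * y + 2 * pi * of_int n \<longleftrightarrow> x = y + 2 * of_int n" for n :: int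
  proof -
    have "pi * x = pi * y + 2 * pi * of_int n \<longleftrightarrow> pi * x = pi * (y + 2 * of_int n)"
      by (simp add: algebra_simps)
    then show ?thesis by (simp del: distrib_left_numeral)
  qed
  then show ?thesis by (simp add: cis_eq_iff)
qed

lemma cis_2pi_eq_iff: "cis (2 * pi * x) = cis (2 * pi * y) \<longleftrightarrow> (\<exists>n::int. x = y + of_int n)"
proof -
  have "2 * x = 2 * y + 2 * of_int n \<longleftrightarrow> x = y + of_int n" for n :: int by linarith
  then show ?thesis using cis_pi_eq_iff[of "2 * x" "2 * y"] by (simp add: mult.assoc mult.left_commute)
qed

lemma torus_cover_eq_iff:
  "torus_cover u = torus_cover v \<longleftrightarrow> (\<exists>m n. even m \<and> v = deck m n u)"
proof
  assume "torus_cover u = torus_cover v"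
  then have "cis (pi * fst v) = cis (pi * fst u)" "cis (2 * pi * snd v) = cis (2 * pi * snd u)"
    by (auto simp: torus_cover_def)
  then obtain i j :: int where "fst v = fst u + 2 * of_int i" "snd v = snd u + of_int j"
    unfolding cis_pi_eq_iff cis_2pi_eq_iff by auto
  then have "v = deck (2 * i) j u" by (simp add: deck_def prod_eq_iff)
  then show "\<exists>m n. even m \<and> v = deck m n u" by (metis dvd_triv_left)
next
  assume "\<exists>m n. even m \<and> v = deck m n u"
  then obtain i j where v: "v = deck (2 * i) j u" by (auto elim!: evenE)
  have "cis (pi * fst v) = cis (pi * fst u)" "cis (2 * pi * snd v) = cis (2 * pi * snd u)"
    unfolding cis_pi_eq_iff cis_2pi_eq_iff by (auto simp: v deck_def)
  then show "torus_cover u = torus_cover v"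
    by (simp add: torus_cover_def)
qed

text \<open>The deck transformation of the orientation covering is induced by the glide reflection.\<close>

lemma torus_deck_torus_cover: "torus_deck (torus_cover u) = torus_cover (deck 1 0 u)"
  by (simp add: torus_deck_def torus_cover_def deck_def minus_cis cis_cnj algebra_simps)

lemma kb_cover_eq_iff: "kb_cover u = kb_cover v \<longleftrightarrow> (\<exists>m n. v = deck m n u)"
proof -
  have "kb_cover u = kb_cover v \<longleftrightarrow> (\<exists>m n. even m \<and> v = deck m n u) \<or> (\<exists>m n. odd m \<and> v = deck m n u)"
  proof -
    have even: "torus_cover v = torus_cover u \<longleftrightarrow> (\<exists>m n. even m \<and> v = deck m n u)"
      by (rule trans[OF eq_commute torus_cover_eq_iff])
    have "torus_cover v = torus_cover (deck 1 0 u) \<longleftrightarrow> (\<exists>m n. even m \<and> v = deck m n (deck 1 0 u))"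
      by (rule trans[OF eq_commute torus_cover_eq_iff])
    also have "\<dots> \<longleftrightarrow> (\<exists>m n. even m \<and> v = deck (m + 1) n u)"
      by (auto simp: deck_deck)
    also have "\<dots> \<longleftrightarrow> (\<exists>m n. odd m \<and> v = deck m n u)"
    proof
      assume "\<exists>m n. odd m \<and> v = deck m n u"
      then obtain m n where "even (m - 1) \<and> v = deck (m - 1 + 1) n u" by auto
      then show "\<exists>m n. even m \<and> v = deck (m + 1) n u" by blast
    qed (metis even_plus_one_iff)
    finally show ?thesis
      unfolding kb_cover_def c2_eq_iff torus_deck_torus_cover even by simp
  qed
  then show ?thesis by blast
qed

lemma kb_cover_deck [simp]: "kb_cover (deck m n u) = kb_cover u"
  using kb_cover_eq_iff by metis

lemma topspace_kb: "topspace klein_bottle = c2 ` (sphere 0 1 \<times> sphere 0 1)"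
  by (simp add: klein_bottle_def torus_def)

lemma continuous_torus_cover: "continuous_map euclidean torus torus_cover"
  unfolding torus_def continuous_map_in_subtopology torus_cover_def
  by (auto intro!: continuous_intros)

lemma continuous_kb_cover: "continuous_map euclidean klein_bottle kb_cover"
proof -
  have "continuous_map torus klein_bottle c2"
    using quotient_map_c2 by (rule quotient_imp_continuous_map)
  from continuous_map_compose[OF continuous_torus_cover this]
  show ?thesis by (simp add: o_def kb_cover_def[abs_def])
qed

lemma kb_cover_in [simp]: "kb_cover u \<in> topspace klein_bottle"
  using continuous_kb_cover by (auto simp: continuous_map_def)

text \<open>A compact fundamental domain, through which continuity on the Klein bottle can be tested by
compactness alone.\<close>

lemma kb_cover_square: "kb_cover ` ({0..2} \<times> {0..1}) = topspace klein_bottle"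
proof
  show "kb_cover ` ({0..2} \<times> {0..1}) \<subseteq> topspace klein_bottle" by auto
  show "topspace klein_bottle \<subseteq> kb_cover ` ({0..2} \<times> {0..1})"
  proof
    fix k assume "k \<in> topspace klein_bottle"
    then obtain z w where zw: "k = c2 (z, w)" "norm z = 1" "norm w = 1"
      by (auto simp: topspace_kb)
    have *: "\<exists>t. 0 \<le> t \<and> t \<le> 1 \<and> z = cis (2 * pi * t)" if "norm z = 1" for z
    proof (intro exI conjI)
      have "0 \<le> Arg2pi z" "Arg2pi z < 2 * pi" by (auto simp: Arg2pi_ge_0 Arg2pi_lt_2pi)
      then show "0 \<le> Arg2pi z / (2 * pi)" "Arg2pi z / (2 * pi) \<le> 1" by auto
      show "z = cis (2 * pi * (Arg2pi z / (2 * pi)))"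
        using Arg2pi_eq[of z] that by (simp add: cis_conv_exp)
    qed
    obtain s t where "0 \<le> s" "s \<le> 1" "z = cis (2 * pi * s)" "0 \<le> t" "t \<le> 1" "w = cis (2 * pi * t)"
      using *[OF zw(2)] *[OF zw(3)] by blast
    then have "k = kb_cover (2 * s, t)" "(2 * s, t) \<in> {0..2} \<times> {0..1}"
      by (auto simp: zw kb_cover_def torus_cover_def mult_ac)
    then show "k \<in> kb_cover ` ({0..2} \<times> {0..1})" by blast
  qed
qed

lemma kb_coverE:
  assumes "k \<in> topspace klein_bottle"
  obtains u where "k = kb_cover u"
  using assms kb_cover_square by blast

text \<open>The functions \<open>z\<^sup>2\<close>, \<open>Re w\<close> and \<open>z * Im w\<close> are invariant under
\<open>(z, w) \<mapsto> (- z, cnj w)\<close> and separate the orbits: \<open>z\<^sup>2\<close> determines \<open>z\<close>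
up to sign, and a choice of the sign then determines \<open>w\<close>. They make the Klein bottle
Hausdorff, and they replace evenly covered neighbourhoods when maps are lifted.\<close>

lemma klein_bottle_coordinates:
  obtains c :: "(complex \<times> complex) set \<Rightarrow> complex \<times> real \<times> complex"
  where "continuous_map klein_bottle euclidean c"
    "\<And>z w. \<lbrakk>norm z = 1; norm w = 1\<rbrakk> \<Longrightarrow> c (c2 (z, w)) = (z\<^sup>2, Re w, z * of_real (Im w))"
proof -
  have cont: "continuous_map torus euclidean
      (\<lambda>p. ((fst p)\<^sup>2, Re (snd p), fst p * of_real (Im (snd p))))"
    unfolding torus_def by (auto intro!: continuous_intros)
  obtain c where "continuous_map klein_bottle euclidean c"
    "\<And>p. p \<in> topspace torus \<Longrightarrow> c (c2 p) = ((fst p)\<^sup>2, Re (snd p), fst p * of_real (Im (snd p)))"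
    by (rule quotient_map_lift_exists[OF quotient_map_c2 cont]) (auto simp: c2_eq_iff torus_deck_def)
  then show ?thesis
    by (intro that[of c]) (auto simp: torus_def)
qed

lemma Hausdorff_klein_bottle: "Hausdorff_space klein_bottle"
proof -
  obtain c where c: "continuous_map klein_bottle euclidean c"
    "\<And>z w. \<lbrakk>norm z = 1; norm w = 1\<rbrakk> \<Longrightarrow> c (c2 (z, w)) = (z\<^sup>2, Re w, z * of_real (Im w))"
    using klein_bottle_coordinates by blast
  have "inj_on c (topspace klein_bottle)"
  proof (rule inj_onI)
    fix k l assume kl: "k \<in> topspace klein_bottle" "l \<in> topspace klein_bottle" "c k = c l"
    then obtain z w z' w' where k: "k = c2 (z, w)" "norm z = 1" "norm w = 1"
      and l: "l = c2 (z', w')" "norm z' = 1" "norm w' = 1"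
      by (auto simp: topspace_kb)
    from kl(3) have eq: "z\<^sup>2 = z'\<^sup>2" "Re w = Re w'" "z * of_real (Im w) = z' * of_real (Im w')"
      using k l c(2) by auto
    have "z' \<noteq> 0" using l by auto
    from eq(1) consider "z = z'" | "z = - z'" by (auto simp: power2_eq_iff)
    then have "(z', w') = (z, w) \<or> (z', w') = torus_deck (z, w)"
    proof cases
      case 1
      then show ?thesis using eq \<open>z' \<noteq> 0\<close> by (auto simp: complex_eq_iff)
    next
      case 2
      then have "z' * of_real (Im w + Im w') = 0" using eq(3) by (simp add: distrib_left neg_eq_iff_add_eq_0)
      then have "Im w' = - Im w" using \<open>z' \<noteq> 0\<close> by (simp del: of_real_add)
      then show ?thesis using 2 eq(2) by (simp add: torus_deck_def complex_eq_iff)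
    qed
    then show "k = l" using k l by (simp add: c2_eq_iff)
  qed
  then show ?thesis
    using Hausdorff_space_injective_preimage[OF _ c(1)] by auto
qed

section \<open>Lifting maps to the plane and descending from it\<close>

lemma unit_circle_angle:
  fixes g :: "'a::real_normed_vector \<Rightarrow> complex"
  assumes "convex S" "continuous_on S g" "\<And>s. s \<in> S \<Longrightarrow> norm (g s) = 1"
  obtains \<theta> where "continuous_on S \<theta>" "\<And>s. s \<in> S \<Longrightarrow> g s = cis (\<theta> s)"
proof -
  obtain L where L: "continuous_on S L" "\<And>s. s \<in> S \<Longrightarrow> g s = exp (L s)"
    using continuous_logarithm_on_contractible[OF assms(2) convex_imp_contractible[OF assms(1)]]
      assms(3) by (metis norm_zero zero_neq_one)
  have "g s = cis (Im (L s))" if "s \<in> S" for s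
  proof -
    have "norm (exp (L s)) = 1" using assms(3) L(2) that by metis
    then have "Re (L s) = 0" by simp
    then show ?thesis using L(2)[OF that] exp_eq_polar[of "L s"] by simp
  qed
  moreover have "continuous_on S (\<lambda>s. Im (L s))" using L(1) by (intro continuous_intros)
  ultimately show ?thesis using that by blast
qed

text \<open>Two logarithms produce the lift. An angle \<open>\<theta>\<close> of the invariant \<open>z\<^sup>2\<close> selects the
square root \<open>cis (\<theta> / 2)\<close> continuously, hence one of the two points \<open>(z, w)\<close> over
each value, and then \<open>w\<close> depends continuously on the parameter and has an angle too.\<close>

lemma klein_bottle_lift:
  fixes f :: "'a::real_normed_vector \<Rightarrow> (complex \<times> complex) set"
  assumes S: "convex S" and f: "continuous_map (top_of_set S) klein_bottle f"
  obtains F where "continuous_on S F" "\<And>s. s \<in> S \<Longrightarrow> kb_cover (F s) = f s"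
proof -
  obtain c where c: "continuous_map klein_bottle euclidean c"
    "\<And>z w. \<lbrakk>norm z = 1; norm w = 1\<rbrakk> \<Longrightarrow> c (c2 (z, w)) = (z\<^sup>2, Re w, z * of_real (Im w))"
    using klein_bottle_coordinates by blast
  have cf: "continuous_on S (\<lambda>s. c (f s))"
    using continuous_map_compose[OF f c(1)] by (simp add: o_def)
  have rep: "\<exists>z w. f s = c2 (z, w) \<and> norm z = 1 \<and> norm w = 1" if "s \<in> S" for s
  proof -
    have "f s \<in> topspace klein_bottle" using f that by (auto simp: continuous_map_def)
    then show ?thesis unfolding topspace_kb by fastforce
  qed
  have "continuous_on S (\<lambda>s. fst (c (f s)))" using cf by (intro continuous_intros)
  moreover have "norm (fst (c (f s))) = 1" if "s \<in> S" for s
    using rep[OF that] c(2) by (auto simp: norm_power)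
  ultimately obtain \<theta> where th: "continuous_on S \<theta>" "\<And>s. s \<in> S \<Longrightarrow> fst (c (f s)) = cis (\<theta> s)"
    using unit_circle_angle[OF S] by metis
  define W where "W s = Complex (fst (snd (c (f s)))) (Re (snd (snd (c (f s))) * cis (- (\<theta> s / 2))))" for s
  (* If z is the other square root, the conjugate of w is recovered, which names the same point. *)
  have W: "norm (W s) = 1 \<and> f s = c2 (cis (\<theta> s / 2), W s)" if s: "s \<in> S" for s
  proof -
    obtain z w where zw: "f s = c2 (z, w)" "norm z = 1" "norm w = 1" using rep[OF s] by blast
    have cfs: "c (f s) = (z\<^sup>2, Re w, z * of_real (Im w))" using zw c(2) by simp
    define e where "e = cis (\<theta> s / 2)"
    have "e\<^sup>2 = cis (\<theta> s)" by (simp add: e_def power2_eq_square cis_mult)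
    then have "z\<^sup>2 = e\<^sup>2" using th(2)[OF s] cfs by simp
    then consider "z = e" | "z = - e" by (auto simp: power2_eq_iff)
    then show ?thesis
    proof cases
      case 1
      have "z * of_real (Im w) * cis (- (\<theta> s / 2)) = of_real (Im w)"
        using 1 by (simp add: e_def cis_mult mult.commute mult.left_commute)
      then have "W s = w" by (simp add: W_def cfs complex_eq_iff)
      then show ?thesis using 1 zw e_def by simp
    next
      case 2
      have "z * of_real (Im w) * cis (- (\<theta> s / 2)) = - of_real (Im w)"
        using 2 by (simp add: e_def cis_mult mult.commute mult.left_commute)
      then have "W s = cnj w" by (simp add: W_def cfs complex_eq_iff)
      then show ?thesis using 2 zw e_def by (simp add: c2_eq_iff torus_deck_def)
    qed
  qed
  have "continuous_on S W"
    unfolding W_def Complex_eq using cf th(1) by (auto intro!: continuous_intros)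
  then obtain \<phi> where ph: "continuous_on S \<phi>" "\<And>s. s \<in> S \<Longrightarrow> W s = cis (\<phi> s)"
    using unit_circle_angle[OF S] W by metis
  show ?thesis
  proof
    show "continuous_on S (\<lambda>s. (\<theta> s / (2 * pi), \<phi> s / (2 * pi)))"
      using th(1) ph(1) by (intro continuous_intros) auto
    show "kb_cover (\<theta> s / (2 * pi), \<phi> s / (2 * pi)) = f s" if "s \<in> S" for s
      using W[OF that] ph(2)[OF that] by (simp add: kb_cover_def torus_cover_def)
  qed
qed

lemma klein_bottle_map_lift:
  assumes "continuous_map klein_bottle klein_bottle f"
  obtains F :: "real \<times> real \<Rightarrow> real \<times> real"
  where "continuous_on UNIV F" "\<And>u. kb_cover (F u) = f (kb_cover u)"
proof -
  have "continuous_map (top_of_set UNIV) klein_bottle (\<lambda>u. f (kb_cover u))"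
    using continuous_map_compose[OF continuous_kb_cover assms] by (simp add: o_def)
  then show ?thesis by (rule klein_bottle_lift[OF convex_UNIV]) (rule that, auto)
qed

lemma integer_valued_constant:
  fixes h :: "'a::topological_space \<Rightarrow> real"
  assumes "connected S" "continuous_on S h" "\<And>s. s \<in> S \<Longrightarrow> h s \<in> \<int>"
  obtains n :: int where "\<And>s. s \<in> S \<Longrightarrow> h s = of_int n"
proof -
  have "h constant_on S"
  proof (rule continuous_discrete_range_constant[OF assms(1,2)])
    fix x assume x: "x \<in> S"
    have "1 \<le> norm (h y - h x)" if "y \<in> S" "h y \<noteq> h x" for y
    proof -
      have "h y - h x \<in> \<int>" "h y - h x \<noteq> 0" using assms(3) x that by auto
      then show ?thesis unfolding real_norm_def by (rule Ints_nonzero_abs_ge1)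
    qed
    then show "\<exists>e>0. \<forall>y. y \<in> S \<and> h y \<noteq> h x \<longrightarrow> e \<le> norm (h y - h x)"
      by (intro exI[of _ 1]) auto
  qed
  then obtain c where c: "\<And>s. s \<in> S \<Longrightarrow> h s = c" unfolding constant_on_def by blast
  show ?thesis
  proof (cases "S = {}")
    case True
    then show ?thesis using that by auto
  next
    case False
    then obtain n :: int where "c = of_int n" using c assms(3) by (metis Ints_cases all_not_in_conv)
    then show ?thesis using that c by auto
  qed
qed

text \<open>Two lifts differ by a deck transformation at each point. Its first index is the difference of
the first coordinates, hence constant; once it is known whether the second coordinate is
reflected, the second index is constant for the same reason.\<close>

lemma klein_bottle_lift_unique:
  fixes F F' :: "'a::topological_space \<Rightarrow> real \<times> real"
  assumes S: "connected S" and F: "continuous_on S F" and F': "continuous_on S F'"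
    and eq: "\<And>s. s \<in> S \<Longrightarrow> kb_cover (F' s) = kb_cover (F s)"
  obtains m n where "\<And>s. s \<in> S \<Longrightarrow> F' s = deck m n (F s)"
proof -
  have ex: "\<exists>m n. F' s = deck m n (F s)" if "s \<in> S" for s
    using eq[OF that] kb_cover_eq_iff by metis
  have "continuous_on S (\<lambda>s. fst (F' s) - fst (F s))" using F F' by (intro continuous_intros)
  moreover have "fst (F' s) - fst (F s) \<in> \<int>" if "s \<in> S" for s
    using ex[OF that] by (auto simp: deck_def)
  ultimately obtain m :: int where m: "\<And>s. s \<in> S \<Longrightarrow> fst (F' s) - fst (F s) = of_int m"
    using integer_valued_constant[OF S] by meson
  have mn: "\<exists>n. F' s = deck m n (F s)" if s: "s \<in> S" for s
  proof -
    obtain m' n where "F' s = deck m' n (F s)" using ex[OF s] by blast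
    moreover from this have "m' = m" using m[OF s] by (simp add: deck_def)
    ultimately show ?thesis by blast
  qed
  have "continuous_on S (\<lambda>s. snd (F' s) - (if even m then snd (F s) else - snd (F s)))"
    using F F' by (cases "even m") (auto intro!: continuous_intros)
  moreover have "snd (F' s) - (if even m then snd (F s) else - snd (F s)) \<in> \<int>" if "s \<in> S" for s
    using mn[OF that] by (auto simp: deck_def)
  ultimately obtain n :: int
    where "\<And>s. s \<in> S \<Longrightarrow> snd (F' s) - (if even m then snd (F s) else - snd (F s)) = of_int n"
    using integer_valued_constant[OF S] by meson
  then have "F' s = deck m n (F s)" if "s \<in> S" for s
    using m[OF that] that by (force simp: deck_def prod_eq_iff)
  then show ?thesis using that by blast
qed

text \<open>The covering restricts to a surjection from a compact square onto a Hausdorff space, and so does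
its product with the unit interval; both are therefore quotient maps. Maps without a parameter are
covered by homotopies that are constant in time.\<close>

lemma klein_bottle_homotopy_descends:
  fixes \<Phi> :: "real \<Rightarrow> real \<times> real \<Rightarrow> 'b"
  assumes cont: "continuous_map (top_of_set ({0..1} \<times> UNIV)) Z (\<lambda>(t, u). \<Phi> t u)"
    and inv: "\<And>t u m n. t \<in> {0..1} \<Longrightarrow> \<Phi> t (deck m n u) = \<Phi> t u"
  obtains h where "continuous_map (prod_topology (top_of_set {0..1}) klein_bottle) Z h"
    "\<And>t u. t \<in> {0..1} \<Longrightarrow> h (t, kb_cover u) = \<Phi> t u"
proof -
  define D :: "(real \<times> real) set" where "D = {0..2} \<times> {0..1}"
  define q where "q = (\<lambda>p::real \<times> real \<times> real. (fst p, kb_cover (snd p)))"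
  let ?X = "top_of_set ({0..1::real} \<times> D)"
  let ?Y = "prod_topology (top_of_set {0..1::real}) klein_bottle"
  have q: "quotient_map ?X ?Y q"
  proof (rule T1_Spaces.continuous_imp_quotient_map)
    show cq: "continuous_map ?X ?Y q"
      unfolding q_def continuous_map_pairwise o_def fst_conv snd_conv
    proof
      show "continuous_map ?X (top_of_set {0..1}) fst"
        by (auto simp: continuous_map_in_subtopology intro!: continuous_intros)
      have "continuous_map ?X euclidean (snd :: real \<times> real \<times> real \<Rightarrow> _)"
        by (auto intro!: continuous_intros)
      from continuous_map_compose[OF this continuous_kb_cover]
      show "continuous_map ?X klein_bottle (\<lambda>p. kb_cover (snd p))" by (simp add: o_def)
    qed
    have "compact ({0..1::real} \<times> D)" unfolding D_def by (intro compact_Times compact_Icc)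
    then show "compact_space ?X" by (simp add: compact_space_subtopology)
    show "Hausdorff_space ?Y"
      using Hausdorff_klein_bottle Hausdorff_space_subtopology[OF Hausdorff_space_euclidean, of "{0..1::real}"]
      by (simp add: Hausdorff_space_prod_topology)
    have "q ` ({0..1} \<times> D) = {0..1} \<times> kb_cover ` D"
      using image_paired_Times[of "\<lambda>t. t" kb_cover "{0..1}" D] by (simp add: q_def case_prod_beta')
    then show "q ` topspace ?X = topspace ?Y"
      using kb_cover_square by (simp add: D_def)
  qed
  have cont': "continuous_map ?X Z (\<lambda>(t, u). \<Phi> t u)"
    by (rule continuous_map_from_subtopology_mono[OF cont]) auto
  have fibre: "(\<lambda>(t, u). \<Phi> t u) p = (\<lambda>(t, u). \<Phi> t u) p'"
    if p: "p \<in> topspace ?X" "p' \<in> topspace ?X" "q p = q p'" for p p'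
  proof -
    obtain t u u' where tu: "p = (t, u)" "p' = (t, u')" "t \<in> {0..1}" "kb_cover u = kb_cover u'"
      using p by (cases p; cases p') (auto simp: q_def)
    then obtain m n where "u' = deck m n u" unfolding kb_cover_eq_iff by blast
    then show ?thesis using inv[OF tu(3), of m n u] tu by simp
  qed
  obtain h where h: "continuous_map ?Y Z h"
    "\<And>p. p \<in> topspace ?X \<Longrightarrow> h (q p) = (\<lambda>(t, u). \<Phi> t u) p"
    by (rule quotient_map_lift_exists[OF q cont'], erule (2) fibre, rule that)
  show ?thesis
  proof (rule that[OF h(1)])
    fix t :: real and u assume t: "t \<in> {0..1}"
    have "kb_cover u \<in> kb_cover ` D" unfolding D_def kb_cover_square by simp
    then obtain u' where u': "u' \<in> D" "kb_cover u = kb_cover u'" by blast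
    then obtain m n where mn: "u' = deck m n u" unfolding kb_cover_eq_iff by blast
    have "h (t, kb_cover u) = h (q (t, u'))" by (simp add: q_def u')
    also have "\<dots> = \<Phi> t u'" using h(2)[of "(t, u')"] t u' by simp
    also have "\<dots> = \<Phi> t u" unfolding mn by (rule inv[OF t])
    finally show "h (t, kb_cover u) = \<Phi> t u" .
  qed
qed

section \<open>Equivariance of lifts\<close>

text \<open>The family \<open>G\<close> stands for the integer powers of a bijection \<open>g\<close>.\<close>

lemma additive_over_iterates:
  fixes h :: "'a \<Rightarrow> 'b::real_vector" and G :: "int \<Rightarrow> 'a \<Rightarrow> 'a"
  assumes h: "\<And>u. h (g u) = h u + c"
    and G: "\<And>u. G 0 u = u" "\<And>i u. G (i + 1) u = g (G i u)"
  shows "h (G i u) = h u + of_int i *\<^sub>R c"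
proof (induction i rule: int_induct[where k = 0])
  case base
  then show ?case by (simp add: G)
next
  case (step1 i)
  then show ?case by (simp add: G h scaleR_left.add)
next
  case (step2 i)
  have "h (G i u) = h (G (i - 1) u) + c" using G(2)[of "i - 1" u] h by simp
  then show ?case using step2 by (simp add: scaleR_left.diff algebra_simps)
qed

lemma additive_over_deck:
  fixes h :: "real \<times> real \<Rightarrow> 'b::real_vector"
  assumes a: "\<And>u. h (deck 1 0 u) = h u + c" and b: "\<And>u. h (deck 0 1 u) = h u + d"
  shows "h (deck m n u) = h u + of_int m *\<^sub>R c + of_int n *\<^sub>R d"
proof -
  have "h (deck 0 n (deck m 0 u)) = h (deck m 0 u) + of_int n *\<^sub>R d"
    by (rule additive_over_iterates[where h = h and g = "deck 0 1", OF b]) (simp_all add: deck_deck add.commute)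
  also have "h (deck m 0 u) = h u + of_int m *\<^sub>R c"
    by (rule additive_over_iterates[where h = h and g = "deck 1 0", OF a]) (simp_all add: deck_deck add.commute)
  finally show ?thesis by (simp add: deck_deck)
qed

lemma invariant_under_deck:
  assumes a: "\<And>u. h (deck 1 0 u) = h u" and b: "\<And>u. h (deck 0 1 u) = h u"
  shows "h (deck m n u) = h u"
proof -
  have *: "h (deck 0 n u) = h u" for n u
  proof (induction n rule: int_induct[where k = 0])
    case (step1 i)
    then show ?case using b[of "deck 0 i u"] by (simp add: deck_deck)
  next
    case (step2 i)
    then show ?case using b[of "deck 0 (i - 1) u"] by (simp add: deck_deck)
  qed simp
  have "h (deck m 0 u) = h u"
  proof (induction m rule: int_induct[where k = 0])
    case (step1 i)
    then show ?case using a[of "deck i 0 u"] by (simp add: deck_deck add.commute)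
  next
    case (step2 i)
    then show ?case using a[of "deck (i - 1) 0 u"] by (simp add: deck_deck)
  qed simp
  then show ?thesis using *[of n "deck m 0 u"] by (simp add: deck_deck)
qed

text \<open>Uniqueness of lifts makes \<open>F\<close> equivariant along an endomorphism of the deck group. Its
form is dictated by the relation \<open>b a b = a\<close>: the image of \<open>b\<close> cannot involve
the glide direction, and it is trivial when the image of \<open>a\<close> is a translation.\<close>

lemma equivariant_lift:
  fixes F :: "real \<times> real \<Rightarrow> real \<times> real"
  assumes F: "continuous_on UNIV F" and f: "\<And>u. kb_cover (F u) = f (kb_cover u)"
  obtains r s v where "\<And>u. F (deck 1 0 u) = deck r s (F u)"
    "\<And>u. F (deck 0 1 u) = deck 0 v (F u)" "even r \<Longrightarrow> v = 0"
proof -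
  have cont: "continuous_on UNIV (\<lambda>u. F (deck m n u))" for m n
    by (rule continuous_on_compose2[OF F]) (auto intro!: continuous_intros)
  have same: "kb_cover (F (deck m n u)) = kb_cover (F u)" for m n u
    by (simp add: f)
  obtain r s where a: "\<And>u. F (deck 1 0 u) = deck r s (F u)"
    using klein_bottle_lift_unique[OF connected_UNIV F cont[of 1 0] same] by (metis UNIV_I)
  obtain \<mu> v where b: "\<And>u. F (deck 0 1 u) = deck \<mu> v (F u)"
    using klein_bottle_lift_unique[OF connected_UNIV F cont[of 0 1] same] by (metis UNIV_I)
  have "F (deck 0 1 (deck 1 0 (deck 0 1 0))) = F (deck 1 0 0)" by (simp add: deck_deck)
  then have "deck \<mu> v (deck r s (deck \<mu> v (F 0))) = deck r s (F 0)" by (simp only: a b)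
  then have eq: "\<mu> = 0" "(if even r then v else - v) + s + v = s"
    by (auto simp: deck_deck deck_inject split: if_splits)
  then have "even r \<Longrightarrow> v = 0" by simp
  with a b eq(1) show ?thesis using that by blast
qed

section \<open>Maps that lift to the torus\<close>

text \<open>A map into the torus that lifts \<open>f\<close> can itself be lifted to the plane, where it differs from
\<open>F\<close> by a deck transformation and takes equal values in the torus at \<open>u\<close> and
\<open>a u\<close>; so the image of \<open>a\<close> has even glide index. Conversely, if \<open>r\<close> is even then
the image of the whole deck group consists of deck transformations of the torus, and \<open>F\<close>
followed by the projection to the torus descends.\<close>

lemma lifts_to_torus_iff_even:
  fixes F :: "real \<times> real \<Rightarrow> real \<times> real"
  assumes F: "continuous_on UNIV F" and f: "\<And>u. kb_cover (F u) = f (kb_cover u)"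
    and a: "\<And>u. F (deck 1 0 u) = deck r s (F u)"
  shows "(\<exists>f'. continuous_map klein_bottle torus f' \<and> (\<forall>x\<in>topspace klein_bottle. c2 (f' x) = f x))
    \<longleftrightarrow> even r"
proof
  assume "\<exists>f'. continuous_map klein_bottle torus f' \<and> (\<forall>x\<in>topspace klein_bottle. c2 (f' x) = f x)"
  then obtain f' where f': "continuous_map klein_bottle torus f'"
    "\<And>x. x \<in> topspace klein_bottle \<Longrightarrow> c2 (f' x) = f x" by blast
  have cont: "continuous_map euclidean torus (\<lambda>u. f' (kb_cover u))"
    using continuous_map_compose[OF continuous_kb_cover f'(1)] by (simp add: o_def)
  then have c: "continuous_on UNIV (\<lambda>u. f' (kb_cover u))"
    unfolding torus_def continuous_map_in_subtopology by simp
  have n: "norm (fst (f' (kb_cover u))) = 1" "norm (snd (f' (kb_cover u))) = 1" for u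
  proof -
    have "f' (kb_cover u) \<in> sphere 0 1 \<times> sphere 0 1"
      using cont by (auto simp: torus_def continuous_map_in_subtopology)
    then show "norm (fst (f' (kb_cover u))) = 1" "norm (snd (f' (kb_cover u))) = 1"
      by (auto simp: mem_Times_iff)
  qed
  have "continuous_on UNIV (\<lambda>u. fst (f' (kb_cover u)))" using c by (intro continuous_intros)
  then obtain \<theta> where th: "continuous_on UNIV \<theta>" "\<And>u. fst (f' (kb_cover u)) = cis (\<theta> u)"
    using unit_circle_angle[OF convex_UNIV] n(1) by (metis UNIV_I)
  have "continuous_on UNIV (\<lambda>u. snd (f' (kb_cover u)))" using c by (intro continuous_intros)
  then obtain \<phi> where ph: "continuous_on UNIV \<phi>" "\<And>u. snd (f' (kb_cover u)) = cis (\<phi> u)"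
    using unit_circle_angle[OF convex_UNIV] n(2) by (metis UNIV_I)
  define E where "E u = (\<theta> u / pi, \<phi> u / (2 * pi))" for u
  have contE: "continuous_on UNIV E"
    unfolding E_def using th(1) ph(1) by (intro continuous_intros) auto
  have E: "torus_cover (E u) = f' (kb_cover u)" for u
    by (simp add: E_def torus_cover_def th(2)[symmetric] ph(2)[symmetric])
  have "kb_cover (E u) = kb_cover (F u)" for u
    unfolding f kb_cover_def[of "E u"] E by (rule f'(2)) simp
  then obtain m k where EF: "\<And>u. E u = deck m k (F u)"
    using klein_bottle_lift_unique[OF connected_UNIV F contE] by (metis UNIV_I)
  have "\<exists>i j. even i \<and> E (deck 1 0 0) = deck i j (E 0)"
    unfolding torus_cover_eq_iff[symmetric] E by simp
  then obtain i j where "even i" "deck m k (deck r s (F 0)) = deck i j (deck m k (F 0))"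
    unfolding EF a by blast
  then show "even r" by (auto simp: deck_deck deck_inject)
next
  assume r: "even r"
  obtain r' s' v where "\<And>u. F (deck 1 0 u) = deck r' s' (F u)"
    and b: "\<And>u. F (deck 0 1 u) = deck 0 v (F u)" "even r' \<Longrightarrow> v = 0"
    by (rule equivariant_lift[OF F f], rule that)
  then have "r' = r" using a by (metis deck_inject)
  then have b: "F (deck 0 1 u) = F u" for u using b r by simp
  define \<Phi> where "\<Phi> u = torus_cover (F u)" for u
  have inv: "\<Phi> (deck m n u) = \<Phi> u" for m n u
  proof (rule invariant_under_deck)
    show "\<Phi> (deck 1 0 u) = \<Phi> u" for u
      unfolding \<Phi>_def by (rule sym, subst torus_cover_eq_iff) (use a r in blast)
    show "\<Phi> (deck 0 1 u) = \<Phi> u" for u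
      unfolding \<Phi>_def b ..
  qed
  have "continuous_map euclidean torus \<Phi>"
    using continuous_map_compose[OF _ continuous_torus_cover, of euclidean F] F
    by (simp add: o_def \<Phi>_def[abs_def])
  then have "continuous_map (top_of_set ({0..1::real} \<times> UNIV)) torus (\<Phi> \<circ> snd)"
    by (rule continuous_map_compose[rotated]) (auto intro!: continuous_intros)
  then have cont: "continuous_map (top_of_set ({0..1::real} \<times> UNIV)) torus (\<lambda>(t, u). \<Phi> u)"
    by (simp add: o_def case_prod_beta')
  obtain h where h: "continuous_map (prod_topology (top_of_set {0..1::real}) klein_bottle) torus h"
    "\<And>t u. t \<in> {0..1} \<Longrightarrow> h (t, kb_cover u) = \<Phi> u"
    by (rule klein_bottle_homotopy_descends[OF cont inv]) (rule that)
  have "continuous_map klein_bottle (prod_topology (top_of_set {0..1::real}) klein_bottle) (\<lambda>x. (0, x))"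
    by (auto simp: continuous_map_pairwise o_def)
  from continuous_map_compose[OF this h(1)]
  have "continuous_map klein_bottle torus (\<lambda>x. h (0, x))" by (simp add: o_def)
  moreover have "c2 (h (0, x)) = f x" if x: "x \<in> topspace klein_bottle" for x
  proof -
    obtain u where u: "x = kb_cover u" using x by (rule kb_coverE)
    have "c2 (\<Phi> u) = kb_cover (F u)" by (simp add: \<Phi>_def kb_cover_def)
    then show ?thesis using h(2)[of 0 u] f u by simp
  qed
  ultimately show "\<exists>f'. continuous_map klein_bottle torus f' \<and>
      (\<forall>x\<in>topspace klein_bottle. c2 (f' x) = f x)" by blast
qed

text \<open>A homotopy also lifts to the plane. The glide index of the lift at the element \<open>a\<close> is the
same at all times, because the space of parameters is connected.\<close>

lemma homotopic_lifts_to_torus: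
  assumes hom: "homotopic_with (\<lambda>_. True) klein_bottle klein_bottle f g"
    and f': "continuous_map klein_bottle torus f'" "\<forall>x\<in>topspace klein_bottle. c2 (f' x) = f x"
  shows "\<exists>g'. continuous_map klein_bottle torus g' \<and> (\<forall>x\<in>topspace klein_bottle. c2 (g' x) = g x)"
proof -
  obtain H where H: "continuous_map (prod_topology (top_of_set {0..1::real}) klein_bottle) klein_bottle H"
    "\<And>x. H (0, x) = f x" "\<And>x. H (1, x) = g x"
    using hom unfolding homotopic_with_def by blast
  define S :: "(real \<times> real \<times> real) set" where "S = {0..1} \<times> UNIV"
  have S: "convex S" unfolding S_def by (intro convex_Times) auto
  have "continuous_map (top_of_set S) (prod_topology (top_of_set {0..1::real}) klein_bottle)
      (\<lambda>p. (fst p, kb_cover (snd p)))"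
    unfolding continuous_map_pairwise o_def fst_conv snd_conv
  proof
    show "continuous_map (top_of_set S) (top_of_set {0..1}) fst"
      by (auto simp: continuous_map_in_subtopology S_def intro!: continuous_intros)
    have "continuous_map (top_of_set S) euclidean snd" by (auto intro!: continuous_intros)
    from continuous_map_compose[OF this continuous_kb_cover]
    show "continuous_map (top_of_set S) klein_bottle (\<lambda>p. kb_cover (snd p))" by (simp add: o_def)
  qed
  from continuous_map_compose[OF this H(1)]
  have "continuous_map (top_of_set S) klein_bottle (\<lambda>p. H (fst p, kb_cover (snd p)))"
    by (simp add: o_def)
  then obtain L where L: "continuous_on S L"
    "\<And>p. p \<in> S \<Longrightarrow> kb_cover (L p) = H (fst p, kb_cover (snd p))"
    by (rule klein_bottle_lift[OF S]) (rule that)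
  have "continuous_on S (\<lambda>p. L (fst p, deck 1 0 (snd p)))"
    by (rule continuous_on_compose2[OF L(1)]) (auto simp: S_def intro!: continuous_intros)
  moreover have "kb_cover (L (fst p, deck 1 0 (snd p))) = kb_cover (L p)" if "p \<in> S" for p
    using that L(2)[of p] L(2)[of "(fst p, deck 1 0 (snd p))"] by (simp add: S_def mem_Times_iff)
  ultimately obtain r s where rs: "\<And>p. p \<in> S \<Longrightarrow> L (fst p, deck 1 0 (snd p)) = deck r s (L p)"
    by (rule klein_bottle_lift_unique[OF convex_connected[OF S] L(1)]) (assumption, rule that)
  have cont: "continuous_on UNIV (\<lambda>u. L (t, u))" if "t \<in> {0..1}" for t
    by (rule continuous_on_compose2[OF L(1)]) (use that in \<open>auto simp: S_def intro!: continuous_intros\<close>)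
  have "even r"
  proof (rule lifts_to_torus_iff_even[THEN iffD1])
    show "continuous_on UNIV (\<lambda>u. L (0, u))" by (rule cont) simp
    show "kb_cover (L (0, u)) = f (kb_cover u)" for u using L(2)[of "(0, u)"] H by (simp add: S_def)
    show "L (0, deck 1 0 u) = deck r s (L (0, u))" for u using rs[of "(0, u)"] by (simp add: S_def)
    show "\<exists>f'. continuous_map klein_bottle torus f' \<and> (\<forall>x\<in>topspace klein_bottle. c2 (f' x) = f x)"
      using f' by blast
  qed
  show ?thesis
  proof (rule lifts_to_torus_iff_even[THEN iffD2])
    show "continuous_on UNIV (\<lambda>u. L (1, u))" by (rule cont) simp
    show "kb_cover (L (1, u)) = g (kb_cover u)" for u using L(2)[of "(1, u)"] H by (simp add: S_def)
    show "L (1, deck 1 0 u) = deck r s (L (1, u))" for u using rs[of "(1, u)"] by (simp add: S_def)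
  qed fact
qed

section \<open>Antisymmetric functions and logarithms\<close>

text \<open>The difference of \<open>L \<circ> g\<close> and \<open>L\<close> is a continuous logarithm of the constant
\<open>c\<close>, and the logarithms of \<open>c\<close> form a discrete set.\<close>

lemma log_translation:
  fixes L :: "real \<times> real \<Rightarrow> complex"
  assumes L: "continuous_on UNIV L" and g: "continuous_on UNIV g"
    and eq: "\<And>u. exp (L (g u)) = c * exp (L u)"
  obtains \<kappa> where "exp \<kappa> = c" "\<And>u. L (g u) = L u + \<kappa>"
proof -
  define h where "h u = L (g u) - L u" for u
  have exp_h: "exp (h u) = c" for u by (simp add: h_def exp_diff eq)
  have n: "\<exists>n::int. h u = h 0 + (of_int (2 * n) * pi) * \<i>" for u
    using exp_eq[of "h u" "h 0"] exp_h by simp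
  define k where "k u = Im (h u - h 0) / (2 * pi)" for u
  have "k u \<in> \<int>" for u
  proof -
    obtain n :: int where "h u = h 0 + (of_int (2 * n) * pi) * \<i>" using n by blast
    then have "k u = of_int n" by (simp add: k_def)
    then show ?thesis by simp
  qed
  moreover have "continuous_on UNIV k"
    unfolding k_def h_def
    by (intro continuous_intros continuous_on_compose2[OF L g] L) auto
  ultimately obtain m :: int where m: "\<And>u. k u = of_int m"
    using integer_valued_constant[OF connected_UNIV] by (metis UNIV_I)
  have "k 0 = 0" by (simp add: k_def)
  have "h u = h 0" for u
  proof -
    obtain n :: int where nu: "h u = h 0 + (of_int (2 * n) * pi) * \<i>" using n by blast
    then have "k u = of_int n" by (simp add: k_def)
    then have "n = 0" using m[of u] m[of 0] \<open>k 0 = 0\<close> by simp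
    then show ?thesis using nu by simp
  qed
  then have "L (g u) = L u + h 0" for u by (metis h_def add_diff_cancel_left' diff_add_cancel)
  then show ?thesis using that exp_h by blast
qed

text \<open>The constant \<open>\<kappa>\<close> is a logarithm of \<open>-1\<close>. What matters later is only that it is not
zero, which makes the antisymmetry visible after \<open>\<sigma>\<close> is applied twice.\<close>

lemma antisymmetric_log:
  fixes D :: "real \<times> real \<Rightarrow> complex"
  assumes D: "continuous_on UNIV D" "\<And>u. D u \<noteq> 0"
    and \<sigma>: "continuous_on UNIV \<sigma>" "\<And>u. D (\<sigma> u) = - D u"
  obtains L \<kappa> where "continuous_on UNIV L" "\<And>u. D u = exp (L u)" "\<kappa> \<noteq> 0" "\<And>u. L (\<sigma> u) = L u + \<kappa>"
proof -
  obtain L where L: "continuous_on UNIV L" "\<And>u. D u = exp (L u)"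
    using continuous_logarithm_on_contractible[OF D(1) convex_imp_contractible[OF convex_UNIV]] D(2)
    by (metis UNIV_I)
  have "exp (L (\<sigma> u)) = - 1 * exp (L u)" for u
    using \<sigma>(2) by (simp add: L(2))
  then obtain \<kappa> where k: "exp \<kappa> = -1" "\<And>u. L (\<sigma> u) = L u + \<kappa>"
    by (rule log_translation[OF L(1) \<sigma>(1)]) (rule that)
  have "\<kappa> \<noteq> 0" using k(1) by auto
  with L k(2) show ?thesis using that by blast
qed

definition plane_to_complex :: "real \<times> real \<Rightarrow> complex" where
  "plane_to_complex u = Complex (fst u) (snd u)"

lemma plane_to_complex_simps [simp]:
  "plane_to_complex (u - v) = plane_to_complex u - plane_to_complex v"
  "plane_to_complex u = 0 \<longleftrightarrow> u = 0"
  by (simp_all add: plane_to_complex_def complex_eq_iff prod_eq_iff)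

lemma continuous_on_plane_to_complex [continuous_intros]:
  "continuous_on S f \<Longrightarrow> continuous_on S (\<lambda>x. plane_to_complex (f x))"
  unfolding plane_to_complex_def Complex_eq by (intro continuous_intros)

text \<open>Without fixed points, \<open>\<sigma> u - u\<close> would be nowhere zero and antisymmetric under
\<open>\<sigma>\<close>, but its logarithm would return to its value after two applications of
\<open>\<sigma>\<close>.\<close>

lemma plane_involution_fixed_point:
  fixes \<sigma> :: "real \<times> real \<Rightarrow> real \<times> real"
  assumes \<sigma>: "continuous_on UNIV \<sigma>" "\<And>u. \<sigma> (\<sigma> u) = u"
  obtains u where "\<sigma> u = u"
proof (rule ccontr)
  assume "\<not> thesis"
  then have free: "\<sigma> u \<noteq> u" for u using that by blast
  define D where "D u = plane_to_complex (\<sigma> u - u)" for u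
  have "continuous_on UNIV D" unfolding D_def by (intro continuous_intros \<sigma>)
  moreover have "D u \<noteq> 0" for u using free by (simp add: D_def del: plane_to_complex_simps(1))
  moreover have "D (\<sigma> u) = - D u" for u by (simp add: D_def \<sigma>(2))
  ultimately obtain L \<kappa> where "\<kappa> \<noteq> 0" "\<And>u. L (\<sigma> u) = L u + (\<kappa>::complex)"
    using antisymmetric_log[OF _ _ \<sigma>(1)] by metis
  then have "L (\<sigma> (\<sigma> 0)) = L 0 + 2 * \<kappa>" by simp
  then show False using \<open>\<kappa> \<noteq> 0\<close> \<sigma>(2) by simp
qed

section \<open>Free involutions of the Klein bottle\<close>

text \<open>What the deck group knows about a lift of a free involution. The square of the lift is a deck
transformation, and comparing the two ways of moving deck transformations past it restricts the
exponents. If the square has no glide part (\<open>n = 0\<close>), then \<open>\<sigma> b\<^sup>l = b\<^sup>l \<sigma>\<close>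
leaves \<open>\<delta> = 1\<close> or \<open>l = 0\<close>, and \<open>l = 0\<close> would make
\<open>\<sigma>\<close> an involution of the plane.\<close>

lemma involution_lift_type:
  assumes \<tau>: "free_involution klein_bottle \<tau>"
    and \<sigma>: "continuous_on UNIV \<sigma>" "\<And>u. kb_cover (\<sigma> u) = \<tau> (kb_cover u)"
  obtains \<epsilon> k \<delta> n l where
    "\<And>u. \<sigma> (deck 1 0 u) = deck \<epsilon> k (\<sigma> u)" "\<And>u. \<sigma> (deck 0 1 u) = deck 0 \<delta> (\<sigma> u)"
    "\<And>u. \<sigma> (\<sigma> u) = deck n l u"
    "odd \<epsilon>" "even n" "\<epsilon> = 1 \<or> \<epsilon> = -1 \<and> n = 0" "\<delta> = 1 \<or> \<delta> = -1"
    "n = 0 \<Longrightarrow> \<delta> = 1 \<and> l \<noteq> 0" "n = 0 \<Longrightarrow> \<epsilon> = 1 \<Longrightarrow> l = k"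
proof -
  obtain \<epsilon> k \<delta> where a: "\<And>u. \<sigma> (deck 1 0 u) = deck \<epsilon> k (\<sigma> u)"
    and b: "\<And>u. \<sigma> (deck 0 1 u) = deck 0 \<delta> (\<sigma> u)" and \<epsilon>\<delta>: "even \<epsilon> \<Longrightarrow> \<delta> = 0"
    by (rule equivariant_lift[OF \<sigma>]) (rule that)
  have inv: "\<tau> (\<tau> x) = x" "\<tau> x \<noteq> x" if "x \<in> topspace klein_bottle" for x
    using \<tau> that by (auto simp: free_involution_def)
  have free: "\<sigma> u \<noteq> u" for u
    using \<sigma>(2)[of u] inv(2)[OF kb_cover_in[of u]] by metis
  have "continuous_on UNIV (\<lambda>u. \<sigma> (\<sigma> u))"
    by (rule continuous_on_compose2[OF \<sigma>(1) \<sigma>(1)]) auto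
  moreover have "kb_cover (\<sigma> (\<sigma> u)) = kb_cover u" for u
    by (simp add: \<sigma>(2) inv)
  ultimately obtain n l where sq: "\<And>u. \<sigma> (\<sigma> u) = deck n l u"
    using klein_bottle_lift_unique[OF connected_UNIV continuous_on_id] by (metis UNIV_I)
  have bj: "\<sigma> (deck 0 j u) = deck 0 (\<delta> * j) (\<sigma> u)" for j u
  proof -
    have "\<sigma> (deck 0 j u) = \<sigma> u + of_int j *\<^sub>R (0, of_int \<delta>)"
      by (rule additive_over_iterates[where g = "deck 0 1"])
        (simp_all add: deck_deck add.commute b, simp add: deck_def prod_eq_iff)
    then show ?thesis by (simp add: deck_def prod_eq_iff)
  qed
  have fst_deck: "fst (\<sigma> (deck i j u)) = fst (\<sigma> u) + of_int (\<epsilon> * i)" for i j u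
  proof -
    have "fst (\<sigma> (deck i j u)) = fst (\<sigma> u) + of_int i *\<^sub>R of_int \<epsilon> + of_int j *\<^sub>R 0"
      by (rule additive_over_deck) (simp_all add: a b, simp_all add: deck_def)
    then show ?thesis by (simp add: mult.commute)
  qed
  (* Conjugation by the square of the lift, computed on b and on a. *)
  have "\<sigma> (\<sigma> (deck 0 1 0)) = deck 0 (\<delta> * \<delta>) (\<sigma> (\<sigma> 0))" by (simp add: b bj)
  then have "deck n l (deck 0 1 0) = deck 0 (\<delta> * \<delta>) (deck n l 0)" by (simp only: sq)
  then have "(if even n then 1 else - 1) = \<delta> * \<delta>" by (auto simp: deck_deck deck_inject)
  then have n: "even n" and "\<delta> * \<delta> = 1"
    using zero_le_square[of \<delta>] by (smt (verit))+
  then have \<delta>: "\<delta> = 1 \<or> \<delta> = -1" by (metis square_eq_1_iff)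
  then have odd: "odd \<epsilon>" using \<epsilon>\<delta> by auto
  have "fst (\<sigma> (\<sigma> (deck 1 0 0))) = fst (\<sigma> (\<sigma> 0)) + of_int (\<epsilon> * \<epsilon>)"
    by (simp only: a fst_deck)
  then have "real_of_int (\<epsilon> * \<epsilon>) = 1" by (simp only: sq) (simp add: deck_def)
  then have "\<epsilon> * \<epsilon> = 1" by linarith
  then have \<epsilon>: "\<epsilon> = 1 \<or> \<epsilon> = -1" by (metis square_eq_1_iff)
  (* The lift commutes with its own square. *)
  have comm: "\<sigma> (deck n l u) = deck n l (\<sigma> u)" for u by (simp only: sq[symmetric])
  then have "fst (\<sigma> (deck n l 0)) = fst (\<sigma> 0) + n" by (simp only: comm) (simp add: deck_def)
  then have "real_of_int (\<epsilon> * n) = real_of_int n" by (simp only: fst_deck)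
  then have en: "\<epsilon> * n = n" by linarith
  have l: "\<delta> = 1 \<and> l \<noteq> 0" if "n = 0"
  proof -
    have "deck 0 (\<delta> * l) (\<sigma> 0) = deck 0 l (\<sigma> 0)" using comm[of 0] that by (simp only: bj)
    then have "\<delta> * l = l" by (simp add: deck_inject)
    moreover have "l \<noteq> 0"
    proof
      assume "l = 0"
      then have "\<sigma> (\<sigma> u) = u" for u using sq that by simp
      then show False using plane_involution_fixed_point[OF \<sigma>(1)] free by metis
    qed
    ultimately show ?thesis using \<delta> by auto
  qed
  have "l = k" if "n = 0" "\<epsilon> = 1"
  proof -
    have "\<sigma> (\<sigma> (deck 1 0 0)) = \<sigma> (deck 0 k (deck 1 0 (\<sigma> 0)))" by (simp add: a deck_deck that)
    also have "\<dots> = deck 0 (\<delta> * k) (deck 1 k (\<sigma> (\<sigma> 0)))" by (simp add: bj a that)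
    finally have "deck 0 l (deck 1 0 0) = deck 0 k (deck 1 k (deck 0 l 0))"
      using l[OF that(1)] that by (simp add: sq)
    then show ?thesis by (simp add: deck_deck deck_inject)
  qed
  then show ?thesis
    using that[OF a b sq odd n] \<epsilon> \<delta> en l by fastforce
qed

text \<open>The lift is adjusted by deck transformations. If \<open>\<epsilon>\<close> were \<open>-1\<close>, then
\<open>a \<rho>\<close> would be another lift with \<open>\<epsilon> = -1\<close> but the opposite sign of
\<open>\<delta>\<close>, although both have to be \<open>1\<close>. So \<open>\<epsilon> = 1\<close>, a power of
\<open>a\<close> removes the glide part of the square, and the square becomes a power \<open>b\<^sup>k\<close>.
Composing with \<open>b\<^sup>-\<^sup>j\<close> lowers \<open>k\<close> by \<open>2 j\<close>: for even \<open>k\<close> the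
square could be made trivial, and for odd \<open>k\<close> it can be made \<open>b\<close>.\<close>

lemma free_involution_normal_lift:
  assumes \<tau>: "free_involution klein_bottle \<tau>"
  obtains \<sigma> where "continuous_on UNIV \<sigma>" "\<And>u. kb_cover (\<sigma> u) = \<tau> (kb_cover u)"
    "\<And>u. \<sigma> (\<sigma> u) = deck 0 1 u" "\<And>u. \<sigma> (deck 1 0 u) = deck 1 1 (\<sigma> u)"
proof -
  have "continuous_map klein_bottle klein_bottle \<tau>" using \<tau> by (simp add: free_involution_def)
  then obtain \<rho> where \<rho>: "continuous_on UNIV \<rho>" "\<And>u. kb_cover (\<rho> u) = \<tau> (kb_cover u)"
    by (rule klein_bottle_map_lift) (rule that)
  obtain \<epsilon> k \<delta> n l where A: "\<And>u. \<rho> (deck 1 0 u) = deck \<epsilon> k (\<rho> u)" "\<And>u. \<rho> (deck 0 1 u) = deck 0 \<delta> (\<rho> u)"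
    "\<And>u. \<rho> (\<rho> u) = deck n l u" "odd \<epsilon>" "even n" "\<epsilon> = 1 \<or> \<epsilon> = -1 \<and> n = 0" "n = 0 \<Longrightarrow> \<delta> = 1 \<and> l \<noteq> 0"
    by (rule involution_lift_type[OF \<tau> \<rho>]) (rule that)
  have \<epsilon>: "\<epsilon> = 1"
  proof (rule ccontr)
    assume "\<epsilon> \<noteq> 1"
    then have e: "\<epsilon> = -1" "\<delta> = 1" using A by auto
    have c: "continuous_on UNIV (\<lambda>u. deck 1 0 (\<rho> u))" using \<rho>(1) by (intro continuous_intros)
    have p: "kb_cover (deck 1 0 (\<rho> u)) = \<tau> (kb_cover u)" for u using \<rho>(2) by simp
    obtain \<epsilon>' k' \<delta>' n' l' where B: "\<And>u. deck 1 0 (\<rho> (deck 1 0 u)) = deck \<epsilon>' k' (deck 1 0 (\<rho> u))"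
      "\<And>u. deck 1 0 (\<rho> (deck 0 1 u)) = deck 0 \<delta>' (deck 1 0 (\<rho> u))"
      "\<And>u. deck 1 0 (\<rho> (deck 1 0 (\<rho> u))) = deck n' l' u"
      "\<epsilon>' = 1 \<or> \<epsilon>' = -1 \<and> n' = 0" "n' = 0 \<Longrightarrow> \<delta>' = 1 \<and> l' \<noteq> 0"
      by (rule involution_lift_type[OF \<tau> c p]) (rule that)
    have "\<epsilon>' = -1" using B(1)[of 0] e by (auto simp: A deck_deck deck_inject)
    moreover have "\<delta>' = -1" using B(2)[of 0] e by (auto simp: A deck_deck deck_inject)
    ultimately show False using B(4,5) by auto
  qed
  obtain m where m: "n = 2 * m" using A(5) by blast
  define \<sigma> where "\<sigma> u = deck (- m) 0 (\<rho> u)" for u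
  have c: "continuous_on UNIV \<sigma>" unfolding \<sigma>_def using \<rho>(1) by (intro continuous_intros)
  have p: "kb_cover (\<sigma> u) = \<tau> (kb_cover u)" for u using \<rho>(2) by (simp add: \<sigma>_def)
  obtain \<epsilon>' k' \<delta>' n' l' where B: "\<And>u. \<sigma> (deck 1 0 u) = deck \<epsilon>' k' (\<sigma> u)"
    "\<And>u. \<sigma> (deck 0 1 u) = deck 0 \<delta>' (\<sigma> u)" "\<And>u. \<sigma> (\<sigma> u) = deck n' l' u"
    "n' = 0 \<Longrightarrow> \<delta>' = 1 \<and> l' \<noteq> 0" "n' = 0 \<Longrightarrow> \<epsilon>' = 1 \<Longrightarrow> l' = k'"
    by (rule involution_lift_type[OF \<tau> c p]) (rule that)
  have e': "\<epsilon>' = 1"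
  proof -
    have "fst (\<sigma> (deck 1 0 0)) = fst (\<sigma> 0) + 1" by (simp add: \<sigma>_def A \<epsilon>) (simp add: deck_def)
    then have "real_of_int \<epsilon>' = 1" by (simp only: B) (simp add: deck_def)
    then show ?thesis by linarith
  qed
  have "n' = 0"
  proof -
    have "fst (\<rho> (deck (- m) 0 (\<rho> 0))) = fst (\<rho> (\<rho> 0)) + of_int (- m) *\<^sub>R 1 + of_int 0 *\<^sub>R 0"
      by (rule additive_over_deck) (simp_all add: A \<epsilon>, simp_all add: deck_def)
    then have "fst (\<sigma> (\<sigma> 0)) = 0"
      by (simp add: \<sigma>_def A(3)) (simp add: deck_def m)
    then show ?thesis by (simp only: B) (simp add: deck_def)
  qed
  then have sq: "\<sigma> (\<sigma> u) = deck 0 k' u" and a: "\<sigma> (deck 1 0 u) = deck 1 k' (\<sigma> u)"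
    and b: "\<sigma> (deck 0 1 u) = deck 0 1 (\<sigma> u)" for u
    using B e' by auto
  have bj: "\<sigma> (deck 0 j u) = deck 0 j (\<sigma> u)" for j u
  proof -
    have "\<sigma> (deck 0 j u) = \<sigma> u + of_int j *\<^sub>R (0, 1)"
      by (rule additive_over_iterates[where g = "deck 0 1"])
        (simp_all add: deck_deck add.commute b, simp add: deck_def prod_eq_iff)
    then show ?thesis by (simp add: deck_def prod_eq_iff)
  qed
  define \<sigma>' where "\<sigma>' j u = deck 0 (- j) (\<sigma> u)" for j u
  have c': "continuous_on UNIV (\<sigma>' j)" for j
    unfolding \<sigma>'_def using c by (intro continuous_intros)
  have p': "kb_cover (\<sigma>' j u) = \<tau> (kb_cover u)" for j u using p by (simp add: \<sigma>'_def)
  have sq': "\<sigma>' j (\<sigma>' j u) = deck 0 (k' - 2 * j) u" for j u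
    by (simp add: \<sigma>'_def bj sq deck_deck)
  have "odd k'"
  proof
    assume "even k'"
    then obtain j where "k' = 2 * j" by blast
    then have "\<sigma>' j (\<sigma>' j u) = u" for u using sq' by simp
    then obtain u where "\<sigma>' j u = u" using plane_involution_fixed_point[OF c'] by metis
    then have "\<tau> (kb_cover u) = kb_cover u" using p' by metis
    then show False using \<tau> kb_cover_in by (auto simp: free_involution_def)
  qed
  then obtain j where j: "k' = 2 * j + 1" by (metis oddE)
  show ?thesis
  proof (rule that[OF c' p', of j])
    show "\<sigma>' j (\<sigma>' j u) = deck 0 1 u" for u using sq' j by simp
    show "\<sigma>' j (deck 1 0 u) = deck 1 1 (\<sigma>' j u)" for u
      by (simp add: \<sigma>'_def a j deck_deck)
  qed
qed

section \<open>Coincidences in the even case\<close>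

text \<open>For even \<open>r\<close> the deck group acts on the values of \<open>F\<close> by translations, so that the
difference \<open>F (\<sigma> u) - F u\<close> is invariant under \<open>a\<close>, and it changes sign under
\<open>\<sigma>\<close>. The relation \<open>b a b = a\<close> does not permit the logarithm of
such a function to grow under \<open>b\<close>.\<close>

lemma lifted_map_has_coincidence:
  assumes \<sigma>: "continuous_on UNIV \<sigma>" "\<And>u. \<sigma> (\<sigma> u) = deck 0 1 u" "\<And>u. \<sigma> (deck 1 0 u) = deck 1 1 (\<sigma> u)"
    and F: "continuous_on UNIV F" "\<And>u. F (deck 1 0 u) = deck r s (F u)" "\<And>u. F (deck 0 1 u) = F u"
    and r: "even r"
  obtains u where "F (\<sigma> u) = F u"
proof (rule ccontr)
  assume "\<not> thesis"
  then have ne: "F (\<sigma> u) \<noteq> F u" for u using that by blast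
  define D where "D u = plane_to_complex (F (\<sigma> u) - F u)" for u
  have "continuous_on UNIV (\<lambda>u. F (\<sigma> u))" by (rule continuous_on_compose2[OF F(1) \<sigma>(1)]) auto
  then have D1: "continuous_on UNIV D" unfolding D_def by (intro continuous_intros F)
  have D2: "D u \<noteq> 0" for u using ne by (simp add: D_def del: plane_to_complex_simps(1))
  have D3: "D (\<sigma> u) = - D u" for u by (simp add: D_def \<sigma>(2) F(3))
  have "F (deck 1 1 u) = F (deck 1 0 u)" for u
    using F(3)[of "deck 1 0 u"] by (simp add: deck_deck)
  then have D4: "D (deck 1 0 u) = D u" for u
    using r by (simp add: D_def \<sigma>(3) F(2)) (simp add: deck_def plane_to_complex_def complex_eq_iff)
  obtain L \<kappa> where L: "continuous_on UNIV L" "\<And>u. D u = exp (L u)" "\<kappa> \<noteq> 0" "\<And>u. L (\<sigma> u) = L u + \<kappa>"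
    by (rule antisymmetric_log[OF D1 D2 \<sigma>(1) D3]) (rule that)
  have b: "L (deck 0 1 u) = L u + 2 * \<kappa>" for u
    using L(4)[of "\<sigma> u"] L(4)[of u] by (simp add: \<sigma>(2))
  have "exp (L (deck 1 0 u)) = 1 * exp (L u)" for u
    using D4 L(2) by simp
  then obtain \<mu> where a: "\<And>u. L (deck 1 0 u) = L u + \<mu>"
    by (rule log_translation[OF L(1) continuous_on_deck[OF continuous_on_id]]) (rule that)
  have "L (deck 0 1 (deck 1 0 (deck 0 1 0))) = L (deck 1 0 0)" by (simp add: deck_deck)
  then have "L 0 + 2 * \<kappa> + \<mu> + 2 * \<kappa> = L 0 + \<mu>" by (simp only: a b)
  then show False using L(3) by simp
qed

section \<open>Maps without coincidences in the odd case\<close>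

text \<open>The orbit averages of the two coordinates. Since \<open>\<sigma>\<^sup>2\<close> is already
a translation, the average over one step is enough; the shift by \<open>1/2\<close> centres \<open>Y\<close>
so that it is odd under the glide reflection.\<close>

lemma involution_adapted_coordinates:
  assumes \<sigma>: "continuous_on UNIV \<sigma>" "\<And>u. \<sigma> (\<sigma> u) = deck 0 1 u" "\<And>u. \<sigma> (deck 1 0 u) = deck 1 1 (\<sigma> u)"
  obtains X Y :: "real \<times> real \<Rightarrow> real" where
    "continuous_on UNIV X" "\<And>u. X (deck 1 0 u) = X u + 1" "\<And>u. X (\<sigma> u) = X u"
    "continuous_on UNIV Y" "\<And>u. Y (deck 1 0 u) = - Y u" "\<And>u. Y (\<sigma> u) = Y u + 1 / 2"
proof -
  define X where "X u = (fst u + fst (\<sigma> u)) / 2" for u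
  define Y where "Y u = (snd u + snd (\<sigma> u) - 1 / 2) / 2" for u
  show ?thesis
  proof
    show "continuous_on UNIV X" "continuous_on UNIV Y"
      unfolding X_def Y_def by (intro continuous_intros \<sigma>(1); simp)+
    show "X (deck 1 0 u) = X u + 1" "Y (deck 1 0 u) = - Y u" for u
      unfolding X_def Y_def \<sigma>(3) by (simp_all add: deck_def field_simps)
    show "X (\<sigma> u) = X u" "Y (\<sigma> u) = Y u + 1 / 2" for u
      unfolding X_def Y_def \<sigma>(2) by (simp_all add: deck_def field_simps)
  qed
qed

text \<open>The linear map \<open>(r X, v Y + s/2)\<close> has the right equivariance. Under \<open>\<sigma>\<close> it
moves its second coordinate by \<open>v/2\<close>, which is not an integer for odd \<open>v\<close>. For even
\<open>v\<close> a small circle is added: \<open>\<sigma>\<close> moves the image by minus a vector of length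
\<open>1/2\<close>, up to an integer in the second coordinate, and such a vector is never
integral. This is compatible with the glide reflection because \<open>r\<close> is odd, so that the
second coordinate is reflected on both sides.\<close>

lemma coincidence_free_equivariant_map:
  assumes \<sigma>: "continuous_on UNIV \<sigma>" "\<And>u. \<sigma> (\<sigma> u) = deck 0 1 u" "\<And>u. \<sigma> (deck 1 0 u) = deck 1 1 (\<sigma> u)"
    and r: "odd r"
  obtains G where "continuous_on UNIV G" "\<And>u. G (deck 1 0 u) = deck r s (G u)"
    "\<And>u. G (deck 0 1 u) = deck 0 v (G u)" "\<And>u. kb_cover (G (\<sigma> u)) \<noteq> kb_cover (G u)"
proof -
  obtain X Y :: "real \<times> real \<Rightarrow> real" where
    X: "continuous_on UNIV X" "\<And>u. X (deck 1 0 u) = X u + 1" "\<And>u. X (\<sigma> u) = X u" and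
    Y: "continuous_on UNIV Y" "\<And>u. Y (deck 1 0 u) = - Y u" "\<And>u. Y (\<sigma> u) = Y u + 1 / 2"
    by (rule involution_adapted_coordinates[OF \<sigma>]) (rule that)
  have b: "X (deck 0 1 u) = X u" "Y (deck 0 1 u) = Y u + 1" for u
    by (simp_all add: \<sigma>(2)[symmetric] X Y)
  define c :: real where "c = (if even v then 1 / 4 else 0)"
  define G where "G u = (of_int r * X u + c * cos (2 * pi * Y u),
      of_int v * Y u + of_int s / 2 + c * sin (2 * pi * Y u))" for u
  have "continuous_on UNIV G"
    unfolding G_def by (intro continuous_intros X Y)
  moreover have "G (deck 1 0 u) = deck r s (G u)" for u
    unfolding G_def X Y using r by (simp add: deck_def algebra_simps)
  moreover have "G (deck 0 1 u) = deck 0 v (G u)" for u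
  proof -
    have "2 * pi * (Y u + 1) = 2 * pi * Y u + 2 * pi" by (simp add: algebra_simps)
    then have "cos (2 * pi * (Y u + 1)) = cos (2 * pi * Y u)" "sin (2 * pi * (Y u + 1)) = sin (2 * pi * Y u)"
      by (simp_all only: cos_periodic sin_periodic)
    then show ?thesis unfolding G_def b by (simp add: deck_def distrib_left)
  qed
  moreover have "kb_cover (G (\<sigma> u)) \<noteq> kb_cover (G u)" for u
  proof
    assume "kb_cover (G (\<sigma> u)) = kb_cover (G u)"
    then obtain m n where mn: "G (\<sigma> u) = deck m n (G u)"
      by (metis kb_cover_eq_iff)
    have "2 * pi * (Y u + 1 / 2) = 2 * pi * Y u + pi" by (simp add: algebra_simps)
    then have "G (\<sigma> u) = (of_int r * X u - c * cos (2 * pi * Y u),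
        of_int v * Y u + of_int v / 2 + of_int s / 2 - c * sin (2 * pi * Y u))"
      by (simp add: G_def X Y algebra_simps)
    then have m: "- 2 * c * cos (2 * pi * Y u) = of_int m"
      and n: "even m \<Longrightarrow> of_int v / 2 - 2 * c * sin (2 * pi * Y u) = of_int n"
      using mn by (auto simp: G_def deck_def algebra_simps)
    (* The first coordinate moves by less than 1, so no glide can be involved. *)
    have "\<bar>2 * c * cos (2 * pi * Y u)\<bar> \<le> 1 / 2 * 1"
      unfolding abs_mult by (intro mult_mono) (auto simp: c_def)
    then have "\<bar>real_of_int m\<bar> < 1" using m by auto
    then have m0: "m = 0" by linarith
    show False
    proof (cases "even v")
      case False
      then have "real_of_int v = 2 * of_int n" using n m0 by (simp add: c_def)
      then have "v = 2 * n" by linarith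
      then show False using False by simp
    next
      case True
      then obtain w where w: "v = 2 * w" by blast
      have "cos (2 * pi * Y u) = 0" using m m0 True by (simp add: c_def)
      then have "(sin (2 * pi * Y u))\<^sup>2 = 1" using sin_cos_squared_add[of "2 * pi * Y u"] by simp
      then have "sin (2 * pi * Y u) = 1 \<or> sin (2 * pi * Y u) = -1" by (simp add: power2_eq_1_iff)
      then have "2 * real_of_int w - 1 = 2 * of_int n \<or> 2 * real_of_int w + 1 = 2 * of_int n"
        using n m0 True w by (auto simp: c_def)
      then have "2 * w - 1 = 2 * n \<or> 2 * w + 1 = 2 * n" by linarith
      then show False by presburger
    qed
  qed
  ultimately show ?thesis using that by blast
qed

lemma deck_convex_combination:
  "deck m n ((1 - t) *\<^sub>R u + t *\<^sub>R w) = (1 - t) *\<^sub>R deck m n u + t *\<^sub>R deck m n w"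
  by (simp add: deck_def prod_eq_iff algebra_simps)

text \<open>Deck transformations are affine, so the segments from \<open>F u\<close> to \<open>G u\<close> are permuted by
them and the straight-line homotopy descends.\<close>

lemma homotopic_of_equivariant_lift:
  assumes F: "continuous_on UNIV F" "\<And>u. F (deck 1 0 u) = deck r s (F u)" "\<And>u. F (deck 0 1 u) = deck 0 v (F u)"
    and G: "continuous_on UNIV G" "\<And>u. G (deck 1 0 u) = deck r s (G u)" "\<And>u. G (deck 0 1 u) = deck 0 v (G u)"
    and f: "\<And>u. kb_cover (F u) = f (kb_cover u)"
  obtains g where "homotopic_with (\<lambda>_. True) klein_bottle klein_bottle f g"
    "\<And>u. kb_cover (G u) = g (kb_cover u)"
proof -
  define K where "K t u = (1 - t) *\<^sub>R F u + t *\<^sub>R G u" for t u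
  have inv: "kb_cover (K t (deck m n u)) = kb_cover (K t u)" for t m n u
  proof (rule invariant_under_deck)
    show "kb_cover (K t (deck 1 0 u)) = kb_cover (K t u)" for u
      unfolding K_def F G deck_convex_combination[symmetric] by simp
    show "kb_cover (K t (deck 0 1 u)) = kb_cover (K t u)" for u
      unfolding K_def F G deck_convex_combination[symmetric] by simp
  qed
  have "continuous_on ({0..1} \<times> UNIV) (\<lambda>p. K (fst p) (snd p))"
    unfolding K_def
    by (intro continuous_intros continuous_on_compose2[OF F(1)] continuous_on_compose2[OF G(1)]) auto
  then have "continuous_map (top_of_set ({0..1} \<times> UNIV)) euclidean (\<lambda>p. K (fst p) (snd p))"
    by simp
  from continuous_map_compose[OF this continuous_kb_cover]
  have cont: "continuous_map (top_of_set ({0..1} \<times> UNIV)) klein_bottle (\<lambda>(t, u). kb_cover (K t u))"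
    by (simp add: o_def case_prod_beta')
  obtain h where h: "continuous_map (prod_topology (top_of_set {0..1}) klein_bottle) klein_bottle h"
    "\<And>t u. t \<in> {0..1} \<Longrightarrow> h (t, kb_cover u) = kb_cover (K t u)"
    by (rule klein_bottle_homotopy_descends[OF cont inv]) (rule that)
  have "homotopic_with (\<lambda>_. True) klein_bottle klein_bottle f (\<lambda>x. h (1, x))"
  proof (subst homotopic_with, simp, intro exI conjI ballI)
    show "continuous_map (prod_topology (top_of_set {0..1}) klein_bottle) klein_bottle h" by fact
    show "h (0, x) = f x" if "x \<in> topspace klein_bottle" for x
    proof -
      obtain u where "x = kb_cover u" using \<open>x \<in> topspace klein_bottle\<close> by (rule kb_coverE)
      then show ?thesis by (simp add: h(2) K_def f)
    qed
  qed auto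
  moreover have "kb_cover (G u) = h (1, kb_cover u)" for u by (simp add: h(2) K_def)
  ultimately show ?thesis using that by blast
qed

section \<open>The Borsuk-Ulam property\<close>

theorem theorem3:
  fixes \<tau> :: "(complex \<times> complex) set \<Rightarrow> (complex \<times> complex) set"
    and \<beta> :: "((complex \<times> complex) set \<Rightarrow> (complex \<times> complex) set) set"
  assumes "free_involution klein_bottle \<tau>"
    and "\<beta> \<in> free_homotopy_classes klein_bottle klein_bottle"
  shows "borsuk_ulam klein_bottle \<tau> \<beta> \<longleftrightarrow> lifts_to_torus klein_bottle \<beta>"
proof -
  let ?hom = "homotopic_with (\<lambda>_. True) klein_bottle klein_bottle"
  obtain f0 where f0: "continuous_map klein_bottle klein_bottle f0" and \<beta>: "\<beta> = {g. ?hom f0 g}"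
    using assms(2) by (auto simp: free_homotopy_classes_def quotient_def)
  have f0_in: "f0 \<in> \<beta>" using f0 by (simp add: \<beta>)
  have cont: "continuous_map klein_bottle klein_bottle f" if "f \<in> \<beta>" for f
    using that homotopic_with_imp_continuous_maps unfolding \<beta> by blast
  obtain \<sigma> where \<sigma>: "continuous_on UNIV \<sigma>" "\<And>u. \<sigma> (\<sigma> u) = deck 0 1 u" "\<And>u. \<sigma> (deck 1 0 u) = deck 1 1 (\<sigma> u)"
    and \<sigma>\<tau>: "\<And>u. kb_cover (\<sigma> u) = \<tau> (kb_cover u)"
    by (rule free_involution_normal_lift[OF assms(1)]) (rule that)
  show ?thesis
  proof
    assume bu: "borsuk_ulam klein_bottle \<tau> \<beta>"
    obtain F where F: "continuous_on UNIV F" "\<And>u. kb_cover (F u) = f0 (kb_cover u)"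
      by (rule klein_bottle_map_lift[OF f0]) (rule that)
    obtain r s v where rsv: "\<And>u. F (deck 1 0 u) = deck r s (F u)" "\<And>u. F (deck 0 1 u) = deck 0 v (F u)"
      by (rule equivariant_lift[OF F]) (rule that)
    have "even r"
    proof (rule ccontr)
      assume "odd r"
      then obtain G where G: "continuous_on UNIV G" "\<And>u. G (deck 1 0 u) = deck r s (G u)"
        "\<And>u. G (deck 0 1 u) = deck 0 v (G u)" "\<And>u. kb_cover (G (\<sigma> u)) \<noteq> kb_cover (G u)"
        by (rule coincidence_free_equivariant_map[OF \<sigma>]) (rule that)
      obtain g where g: "?hom f0 g" "\<And>u. kb_cover (G u) = g (kb_cover u)"
        by (rule homotopic_of_equivariant_lift[OF F(1) rsv G(1-3) F(2)]) (rule that)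
      then obtain x where x: "x \<in> topspace klein_bottle" "g (\<tau> x) = g x"
        using bu by (auto simp: borsuk_ulam_def \<beta>)
      obtain u where "x = kb_cover u" using x(1) by (rule kb_coverE)
      then show False using x(2) G(4)[of u] by (simp add: g(2) \<sigma>\<tau>)
    qed
    then show "lifts_to_torus klein_bottle \<beta>"
      using lifts_to_torus_iff_even[OF F rsv(1)] f0_in by (auto simp: lifts_to_torus_def)
  next
    assume "lifts_to_torus klein_bottle \<beta>"
    then obtain f1 f' where f1: "f1 \<in> \<beta>" and f': "continuous_map klein_bottle torus f'"
      "\<forall>x\<in>topspace klein_bottle. c2 (f' x) = f1 x"
      by (auto simp: lifts_to_torus_def)
    show "borsuk_ulam klein_bottle \<tau> \<beta>"
      unfolding borsuk_ulam_def
    proof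
      fix f assume f: "f \<in> \<beta>"
      have "?hom f1 f"
        using f f1 homotopic_with_trans homotopic_with_sym unfolding \<beta> by blast
      then have lifts: "\<exists>g'. continuous_map klein_bottle torus g' \<and> (\<forall>x\<in>topspace klein_bottle. c2 (g' x) = f x)"
        using f' by (rule homotopic_lifts_to_torus)
      obtain F where F: "continuous_on UNIV F" "\<And>u. kb_cover (F u) = f (kb_cover u)"
        by (rule klein_bottle_map_lift[OF cont[OF f]]) (rule that)
      obtain r s v where rsv: "\<And>u. F (deck 1 0 u) = deck r s (F u)"
        "\<And>u. F (deck 0 1 u) = deck 0 v (F u)" "even r \<Longrightarrow> v = 0"
        by (rule equivariant_lift[OF F]) (rule that)
      have r: "even r" using lifts_to_torus_iff_even[OF F rsv(1)] lifts by blast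
      then have "F (deck 0 1 u) = F u" for u using rsv by simp
      then obtain u where "F (\<sigma> u) = F u"
        by (rule lifted_map_has_coincidence[OF \<sigma> F(1) rsv(1) _ r]) (rule that)
      then have "f (\<tau> (kb_cover u)) = f (kb_cover u)"
        by (metis F(2) \<sigma>\<tau>)
      then show "\<exists>x\<in>topspace klein_bottle. f (\<tau> x) = f x" using kb_cover_in by blast
    qed
  qed
qed

end
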